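(* Let $\beta\in(\frac{1+\sqrt5}{2},2)$. Then $\widetilde U_\beta$ is a subshift of finite type if and only if the quasi-greedy orbit of $1$ enters the switch region $[\beta^{-1},\beta^{-1}(\beta-1)^{-1}]$ and its first entrance lies in $(\beta^{-1},\beta^{-1}(\beta-1)^{-1}]$; that is, iff there exists $n\ge1$ with $Q^n(1)\in(\beta^{-1},\beta^{-1}(\beta-1)^{-1}]$ and $Q^i(1)\notin[\beta^{-1},\beta^{-1}(\beta-1)^{-1}]$ for $1\le i<n$.
   Context: For $x\in[0,(\beta-1)^{-1}]$, a $\beta$-expansion of $x$ is $(a_n)\in\{0,1\}^{\mathbb{N}}$ with $x=\sum_n a_n\beta^{-n}$. $\widetilde U_\beta\subseteq\{0,1\}^{\mathbb{N}}$ is the set of sequences that are the unique $\beta$-expansion of the number they represent. The greedy expansion of $x$ is produced by the map $G(x)=\beta x\bmod1$ on $[0,1)$, $G(x)=\beta x-1$ on $[1,(\beta-1)^{-1}]$, with digits $\lfloor\beta G^{n-1}(x)\rfloor$. The quasi-greedy expansion $(\eta_i)$ of $1$ equals the greedy expansion of $1$ if that is infinite; if the greedy expansion is $a_1\cdots a_n0^\infty$ with $a_n=1$, then $(\eta_i)=(a_1\cdots a_{n-1}(a_n-1))^\infty$. The quasi-greedy orbit of $1$ is $Q^i(1)=\sum_{j\ge1}\eta_{i+j}\beta^{-j}$, $i\ge1$. A subshift of finite type is a subset of $\{0,1\}^{\mathbb{N}}$ consisting of all sequences avoiding some finite set of forbidden words. *)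

theory Defs
  imports Complex_Main
begin

(* Sequences in {0,1}^N are functions s :: nat => nat with values in {0,1};
   index 0-based: s 0, s 1, ... stand for a_1, a_2, ... *)
definition binseqs :: "(nat \<Rightarrow> nat) set" where
  "binseqs = {s. \<forall>n. s n \<in> {0,1}}"

definition beta_val :: "real \<Rightarrow> (nat \<Rightarrow> nat) \<Rightarrow> real" where
  "beta_val \<beta> s = (\<Sum>n. real (s n) / \<beta> ^ (Suc n))"

definition is_beta_exp :: "real \<Rightarrow> real \<Rightarrow> (nat \<Rightarrow> nat) \<Rightarrow> bool" where
  "is_beta_exp \<beta> x s \<longleftrightarrow> s \<in> binseqs \<and> x = beta_val \<beta> s"

definition Utilde :: "real \<Rightarrow> (nat \<Rightarrow> nat) set" where
  "Utilde \<beta> = {s \<in> binseqs. \<forall>t. is_beta_exp \<beta> (beta_val \<beta> s) t \<longrightarrow> t = s}"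

definition greedy_map :: "real \<Rightarrow> real \<Rightarrow> real" where
  "greedy_map \<beta> x = (if x < 1 then \<beta> * x - of_int \<lfloor>\<beta> * x\<rfloor> else \<beta> * x - 1)"

definition greedy_exp :: "real \<Rightarrow> real \<Rightarrow> nat \<Rightarrow> nat" where
  "greedy_exp \<beta> x n = nat \<lfloor>\<beta> * (greedy_map \<beta> ^^ n) x\<rfloor>"

definition quasi_greedy_one :: "real \<Rightarrow> nat \<Rightarrow> nat" where
  "quasi_greedy_one \<beta> =
     (let g = greedy_exp \<beta> 1 in
      if infinite {n. g n \<noteq> 0} then g
      else (let m = Max {n. g n \<noteq> 0} in
            (\<lambda>k. if k mod (Suc m) = m then g m - 1 else g (k mod (Suc m)))))"

definition Q_orbit :: "real \<Rightarrow> nat \<Rightarrow> real" where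
  "Q_orbit \<beta> i = (\<Sum>j. real (quasi_greedy_one \<beta> (i + j)) / \<beta> ^ (Suc j))"

definition occurs_in :: "nat list \<Rightarrow> (nat \<Rightarrow> nat) \<Rightarrow> bool" where
  "occurs_in w s \<longleftrightarrow> (\<exists>k. \<forall>i < length w. s (k + i) = w ! i)"

definition is_SFT :: "(nat \<Rightarrow> nat) set \<Rightarrow> bool" where
  "is_SFT X \<longleftrightarrow> (\<exists>F. finite F \<and> X = {s \<in> binseqs. \<forall>w \<in> F. \<not> occurs_in w s})"

end

theory Submission
  imports Defs
begin

text \<open>
  A sequence is a unique expansion iff every tail following a digit 0 has value less than 1 and the
  same holds for the reflected sequence (0 and 1 exchanged). Let \<open>\<eta>\<close> be the quasi-greedy expansion
  of 1.

  If the orbit of 1 first enters the switch region at time \<open>n\<close> and to the right of its left endpoint,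
  then unique expansions are exactly the sequences in which neither the words
  \<open>0 \<eta>\<^sub>0 \<dots> \<eta>\<^sub>i\<^sub>-\<^sub>1 1\<close> with \<open>i = n\<close>, or \<open>i < n\<close> and \<open>\<eta>\<^sub>i = 0\<close>, nor their reflections occur.

  Otherwise the orbit meets the switch region at most in its left endpoint, where it restarts at 1, so
  every shift of \<open>\<eta>\<close> lies strictly above the reflection of \<open>\<eta>\<close>. There are then arbitrarily long
  prefixes \<open>w\<close> of \<open>\<eta>\<close> none of whose suffixes is a prefix of the reflection of \<open>\<eta>\<close>, and for such \<open>w\<close>,
  with reflection \<open>w'\<close>, the sequence \<open>0 (w w')\<^sup>\<infinity>\<close> is a unique expansion. These sequences converge to
  \<open>0 \<eta>\<close>, which is not one, since its value is the left endpoint of the switch region. So the set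
  is not closed, whereas subshifts of finite type are.
\<close>

section \<open>Binary sequences, reflection, and two growth arguments\<close>

definition tail_val :: "real \<Rightarrow> (nat \<Rightarrow> nat) \<Rightarrow> nat \<Rightarrow> real" where
  "tail_val \<beta> s k = beta_val \<beta> (\<lambda>j. s (k + j))"

definition flip :: "(nat \<Rightarrow> nat) \<Rightarrow> nat \<Rightarrow> nat" where
  "flip s = (\<lambda>n. 1 - s n)"

definition lexless :: "(nat \<Rightarrow> nat) \<Rightarrow> (nat \<Rightarrow> nat) \<Rightarrow> bool" where
  "lexless s t \<longleftrightarrow> (\<exists>j. (\<forall>i<j. s i = t i) \<and> s j < t j)"

lemma binseqs_cases: "s \<in> binseqs \<Longrightarrow> s n = 0 \<or> s n = 1"
  by (auto simp: binseqs_def)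

lemma binseqs_tail: "s \<in> binseqs \<Longrightarrow> (\<lambda>j. s (k + j)) \<in> binseqs"
  by (auto simp: binseqs_def)

lemma flip_binseqs: "flip s \<in> binseqs"
  by (auto simp: binseqs_def flip_def)

lemma flip_flip: "s \<in> binseqs \<Longrightarrow> flip (flip s) = s"
proof (rule ext)
  show "flip (flip s) n = s n" if "s \<in> binseqs" for n
    using binseqs_cases[OF that, of n] by (auto simp: flip_def)
qed

lemma Q_orbit_eq_tail_val: "Q_orbit \<beta> i = tail_val \<beta> (quasi_greedy_one \<beta>) i"
  by (simp add: Q_orbit_def tail_val_def beta_val_def)

lemma expanding_bounded_zero:
  fixes d :: "nat \<Rightarrow> real"
  assumes "1 < \<beta>" and step: "\<And>k. d (Suc k) = \<beta> * d k" and bound: "\<And>k. \<bar>d k\<bar> \<le> B"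
  shows "d k = 0"
proof (rule ccontr)
  assume nz: "d k \<noteq> 0"
  have pow: "d (k + n) = \<beta> ^ n * d k" for n
    by (induction n) (simp_all add: step)
  obtain n where "B / \<bar>d k\<bar> < \<beta> ^ n"
    using real_arch_pow[OF \<open>1 < \<beta>\<close>] by blast
  then have "B < \<beta> ^ n * \<bar>d k\<bar>"
    using nz by (simp add: pos_divide_less_eq)
  also have "\<dots> = \<bar>d (k + n)\<bar>"
    using \<open>1 < \<beta>\<close> by (simp add: pow abs_mult)
  finally show False
    using bound[of "k + n"] by simp
qed

text \<open>Applied with \<open>P\<close> for "digit 0 at \<open>k\<close>" and \<open>f\<close> for
  the excess over 1 of the tail behind it. Strictness in \<open>grow\<close> makes even an excess of
  0 positive after one step; from then on it grows geometrically, past \<open>B\<close>.\<close>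

lemma growth_bounded_neg:
  fixes f :: "nat \<Rightarrow> real"
  assumes "1 < \<beta>" and bound: "\<And>k. f k \<le> B"
    and grow: "\<And>k. P k \<Longrightarrow> 0 \<le> f k \<Longrightarrow> \<exists>k'. P k' \<and> \<beta> * f k < f k'"
    and "P k"
  shows "f k < 0"
proof (rule ccontr)
  assume "\<not> f k < 0"
  then obtain k1 where k1: "P k1" "\<beta> * f k < f k1"
    using grow[OF \<open>P k\<close>] by auto
  have "0 \<le> \<beta> * f k"
    using \<open>\<not> f k < 0\<close> \<open>1 < \<beta>\<close> by simp
  then have pos: "0 < f k1"
    using k1(2) by linarith
  have ex: "\<exists>k'. P k' \<and> \<beta> ^ n * f k1 \<le> f k'" for n
  proof (induction n)
    case 0
    show ?case using k1(1) by auto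
  next
    case (Suc n)
    then obtain k' where k': "P k'" "\<beta> ^ n * f k1 \<le> f k'" by blast
    have "0 \<le> \<beta> ^ n * f k1"
      using pos \<open>1 < \<beta>\<close> by simp
    then obtain k'' where k'': "P k''" "\<beta> * f k' < f k''"
      using grow[OF k'(1)] k'(2) by auto
    have "\<beta> ^ Suc n * f k1 \<le> \<beta> * f k'"
      using mult_left_mono[OF k'(2), of \<beta>] \<open>1 < \<beta>\<close> by (simp add: mult.assoc)
    then show ?case
      using k'' by (intro exI[of _ k'']) auto
  qed
  obtain n where "B / f k1 < \<beta> ^ n"
    using real_arch_pow[OF \<open>1 < \<beta>\<close>] by blast
  then have "B < \<beta> ^ n * f k1"
    using pos by (simp add: pos_divide_less_eq)
  then show False
    using ex[of n] bound by (meson less_le_trans not_le)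
qed

subsection \<open>Values of tails\<close>

context
  fixes \<beta> :: real
  assumes \<beta>_gt_1: "1 < \<beta>"
begin

lemma sums_geometric_Suc: "(\<lambda>n. 1 / \<beta> ^ Suc n) sums (1 / (\<beta> - 1))"
proof -
  have "(\<lambda>n. 1 / \<beta> * (1 / \<beta>) ^ n) sums (1 / \<beta> * (1 / (1 - 1 / \<beta>)))"
    using \<beta>_gt_1 by (intro sums_mult geometric_sums) simp
  moreover have "1 / \<beta> * (1 / (1 - 1 / \<beta>)) = 1 / (\<beta> - 1)"
    using \<beta>_gt_1 by (simp add: field_simps)
  ultimately show ?thesis
    by (simp add: power_one_over)
qed

lemma summable_digits:
  assumes "s \<in> binseqs"
  shows "summable (\<lambda>n. real (s n) / \<beta> ^ Suc n)"
proof (rule summable_comparison_test')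
  show "summable (\<lambda>n. 1 / \<beta> ^ Suc n)"
    using sums_geometric_Suc by (rule sums_summable)
  show "norm (real (s n) / \<beta> ^ Suc n) \<le> 1 / \<beta> ^ Suc n" if "0 \<le> n" for n
    using binseqs_cases[OF assms, of n] \<beta>_gt_1 by auto
qed

lemma tail_val_Suc:
  assumes "s \<in> binseqs"
  shows "tail_val \<beta> s (Suc k) = \<beta> * tail_val \<beta> s k - real (s k)"
proof -
  let ?f = "\<lambda>n. real (s (k + n)) / \<beta> ^ Suc n"
  have sm: "summable ?f"
    using summable_digits[OF binseqs_tail[OF assms]] .
  have "tail_val \<beta> s k = ?f 0 + (\<Sum>n. ?f (Suc n))"
    using suminf_split_head[OF sm] by (simp add: tail_val_def beta_val_def)
  moreover have "(\<Sum>n. ?f (Suc n)) = tail_val \<beta> s (Suc k) / \<beta>"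
  proof -
    have "(\<lambda>n. ?f (Suc n)) = (\<lambda>n. real (s (Suc k + n)) / \<beta> ^ Suc n / \<beta>)"
      by (auto simp: mult.commute)
    then show ?thesis
      using suminf_divide[OF summable_digits[OF binseqs_tail[OF assms, of "Suc k"]], of \<beta>]
      by (simp add: tail_val_def beta_val_def)
  qed
  ultimately show ?thesis
    using \<beta>_gt_1 by (simp add: field_simps)
qed

lemma tail_val_nonneg: "s \<in> binseqs \<Longrightarrow> 0 \<le> tail_val \<beta> s k"
  unfolding tail_val_def beta_val_def
  using summable_digits[OF binseqs_tail[of s k]] \<beta>_gt_1 by (intro suminf_nonneg) auto

lemma tail_val_flip:
  assumes "s \<in> binseqs"
  shows "tail_val \<beta> (flip s) k = 1 / (\<beta> - 1) - tail_val \<beta> s k"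
proof -
  have "(\<lambda>n. 1 / \<beta> ^ Suc n - real (s (k + n)) / \<beta> ^ Suc n)
      sums (1 / (\<beta> - 1) - tail_val \<beta> s k)"
    unfolding tail_val_def beta_val_def
    by (intro sums_diff sums_geometric_Suc summable_sums summable_digits binseqs_tail assms)
  moreover have "1 / \<beta> ^ Suc n - real (s (k + n)) / \<beta> ^ Suc n = real (flip s (k + n)) / \<beta> ^ Suc n" for n
    using binseqs_cases[OF assms, of "k + n"] by (auto simp: flip_def)
  ultimately have "(\<lambda>n. real (flip s (k + n)) / \<beta> ^ Suc n) sums (1 / (\<beta> - 1) - tail_val \<beta> s k)"
    by simp
  then show ?thesis
    using sums_unique unfolding tail_val_def beta_val_def by metis
qed

lemma tail_val_le: "s \<in> binseqs \<Longrightarrow> tail_val \<beta> s k \<le> 1 / (\<beta> - 1)"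
  using tail_val_flip[of s k] tail_val_nonneg[OF flip_binseqs, of s k] by simp

text \<open>Two bounded solutions of the recursion differ by an amount that is multiplied by
  \<open>\<beta>\<close> at each step, hence by 0.\<close>

lemma tail_val_unique:
  assumes s: "s \<in> binseqs" and step: "\<And>k. r (Suc k) = \<beta> * r k - real (s k)"
    and bound: "\<And>k. \<bar>r k\<bar> \<le> B"
  shows "tail_val \<beta> s k = r k"
proof -
  have "tail_val \<beta> s k - r k = 0"
  proof (rule expanding_bounded_zero[OF \<beta>_gt_1])
    show "tail_val \<beta> s (Suc k) - r (Suc k) = \<beta> * (tail_val \<beta> s k - r k)" for k
      using step[of k] tail_val_Suc[OF s, of k] by (simp add: algebra_simps)
    show "\<bar>tail_val \<beta> s k - r k\<bar> \<le> 1 / (\<beta> - 1) + B" for k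
      using bound[of k] tail_val_nonneg[OF s, of k] tail_val_le[OF s, of k] by linarith
  qed
  then show ?thesis by simp
qed

lemma tail_val_agree:
  assumes s: "s \<in> binseqs" and t: "t \<in> binseqs" and "\<forall>i<j. s (k + i) = t (l + i)"
  shows "tail_val \<beta> s (k + j) - tail_val \<beta> t (l + j) = \<beta> ^ j * (tail_val \<beta> s k - tail_val \<beta> t l)"
  using assms(3)
proof (induction j)
  case (Suc j)
  from Suc.prems have "tail_val \<beta> s (k + Suc j) - tail_val \<beta> t (l + Suc j)
      = \<beta> * (tail_val \<beta> s (k + j) - tail_val \<beta> t (l + j))"
    using tail_val_Suc[OF s, of "k + j"] tail_val_Suc[OF t, of "l + j"]
    by (simp add: right_diff_distrib)
  then show ?case
    using Suc by simp
qed simp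

end

subsection \<open>Unique expansions\<close>

context
  fixes \<beta> :: real
  assumes \<beta>: "1 < \<beta>" "\<beta> < 2"
begin

lemma expansion_exists:
  assumes "0 \<le> y" "y \<le> 1 / (\<beta> - 1)"
  obtains e where "e \<in> binseqs" "tail_val \<beta> e 0 = y"
proof -
  \<comment> \<open>Digit 1 is taken whenever the remainder stays nonnegative. The interval is
    preserved because \<open>1 / (\<beta> - 1)\<close> is at least 1 and is fixed by
    \<open>\<beta> * r - 1\<close>.\<close>
  define f where "f = (\<lambda>r. if \<beta> * r \<ge> 1 then \<beta> * r - 1 else \<beta> * r)"
  define r where "r = (\<lambda>n. (f ^^ n) y)"
  define e where "e = (\<lambda>n. if \<beta> * r n \<ge> 1 then 1 else 0 :: nat)"
  have e: "e \<in> binseqs"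
    by (auto simp: e_def binseqs_def)
  have step: "r (Suc n) = \<beta> * r n - real (e n)" for n
    by (simp add: r_def e_def f_def)
  have one: "1 \<le> 1 / (\<beta> - 1)" and id: "\<beta> * (1 / (\<beta> - 1)) - 1 = 1 / (\<beta> - 1)"
    using \<beta> by (simp_all add: field_simps)
  have rng: "0 \<le> r n \<and> r n \<le> 1 / (\<beta> - 1)" for n
  proof (induction n)
    case 0
    show ?case using assms by (simp add: r_def)
  next
    case (Suc n)
    have "\<beta> * r n \<le> \<beta> * (1 / (\<beta> - 1))"
      using Suc \<beta> by (intro mult_left_mono) auto
    moreover have "0 \<le> \<beta> * r n"
      using Suc \<beta> by simp
    ultimately show ?case
      using one id by (auto simp: step e_def)
  qed
  have "tail_val \<beta> e 0 = r 0"
    by (rule tail_val_unique[OF \<beta>(1) e step, of "1 / (\<beta> - 1)"]) (use rng in auto)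
  then show thesis
    using e that by (simp add: r_def)
qed

text \<open>The digit at \<open>k\<close> can be switched exactly when the remainder left by the
  other digit lies in \<open>[0, 1 / (\<beta> - 1)]\<close>, the range of all values. The two
  inequalities put that remainder outside this range.\<close>

lemma Utilde_iff_tail_val:
  "s \<in> Utilde \<beta> \<longleftrightarrow> s \<in> binseqs \<and>
    (\<forall>k. (s k = 0 \<longrightarrow> tail_val \<beta> s (Suc k) < 1) \<and>
         (s k = 1 \<longrightarrow> 1 / (\<beta> - 1) - 1 < tail_val \<beta> s (Suc k)))"
    (is "_ \<longleftrightarrow> _ \<and> (\<forall>k. ?C k)")
proof
  have val0: "beta_val \<beta> t = tail_val \<beta> t 0" for t
    by (simp add: tail_val_def)
  show "s \<in> binseqs \<and> (\<forall>k. ?C k)" if U: "s \<in> Utilde \<beta>"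
  proof (intro conjI[OF _ allI])
    show s: "s \<in> binseqs"
      using U by (simp add: Utilde_def)
    fix k
    show "?C k"
    proof (rule ccontr)
      assume neg: "\<not> ?C k"
      \<comment> \<open>The value left for the digits after \<open>k\<close> once the digit at
        \<open>k\<close> is switched.\<close>
      define y where "y = \<beta> * tail_val \<beta> s k - real (1 - s k)"
      have "0 \<le> y" "y \<le> 1 / (\<beta> - 1)"
        using neg tail_val_Suc[OF \<beta>(1) s, of k] tail_val_nonneg[OF \<beta>(1) s, of "Suc k"]
          tail_val_le[OF \<beta>(1) s, of "Suc k"]
        by (auto simp: y_def)
      then obtain e where e: "e \<in> binseqs" "tail_val \<beta> e 0 = y"
        by (rule expansion_exists)
      define t where "t = (\<lambda>n. if n < k then s n else if n = k then 1 - s k else e (n - Suc k))"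
      have t: "t \<in> binseqs"
        using s e(1) by (auto simp: t_def binseqs_def)
      have "tail_val \<beta> t (Suc k) = y"
        using e(2) by (simp add: t_def tail_val_def)
      then have "tail_val \<beta> t k = tail_val \<beta> s k"
        using tail_val_Suc[OF \<beta>(1) t, of k] \<beta> by (simp add: y_def t_def)
      moreover have "tail_val \<beta> t (0 + k) - tail_val \<beta> s (0 + k)
          = \<beta> ^ k * (tail_val \<beta> t 0 - tail_val \<beta> s 0)"
        by (rule tail_val_agree[OF \<beta>(1) t s]) (simp add: t_def)
      ultimately have "tail_val \<beta> t 0 = tail_val \<beta> s 0"
        using \<beta> by simp
      then have "t = s"
        using U t by (simp add: Utilde_def is_beta_exp_def val0)
      then have "t k = s k" by simp
      then show False
        using binseqs_cases[OF s, of k] by (auto simp: t_def)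
    qed
  qed
  show "s \<in> Utilde \<beta>" if "s \<in> binseqs \<and> (\<forall>k. ?C k)"
  proof -
    from that have s: "s \<in> binseqs" and C: "?C k" for k by auto
    have "t = s" if t: "t \<in> binseqs" and eq: "tail_val \<beta> s 0 = tail_val \<beta> t 0" for t
    proof (rule ccontr)
      assume "t \<noteq> s"
      then have ex: "\<exists>k. t k \<noteq> s k" by auto
      \<comment> \<open>At the first differing digit both tails still have the same value, so
        \<open>t\<close> would have to continue with a value outside the range.\<close>
      define k where "k = (LEAST k. t k \<noteq> s k)"
      have k: "t k \<noteq> s k"
        unfolding k_def by (rule LeastI_ex[OF ex])
      have less: "t i = s i" if "i < k" for i
        using not_less_Least[of i] that unfolding k_def by blast
      have "tail_val \<beta> t (0 + k) - tail_val \<beta> s (0 + k)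
          = \<beta> ^ k * (tail_val \<beta> t 0 - tail_val \<beta> s 0)"
        by (rule tail_val_agree[OF \<beta>(1) t s]) (simp add: less)
      then have "tail_val \<beta> t k = tail_val \<beta> s k"
        using eq by simp
      then have "tail_val \<beta> t (Suc k) + t k = tail_val \<beta> s (Suc k) + s k"
        using tail_val_Suc[OF \<beta>(1) t, of k] tail_val_Suc[OF \<beta>(1) s, of k] by simp
      then show False
        using k C[of k] binseqs_cases[OF s, of k] binseqs_cases[OF t, of k]
          tail_val_nonneg[OF \<beta>(1) t, of "Suc k"] tail_val_le[OF \<beta>(1) t, of "Suc k"]
        by auto
    qed
    then show ?thesis
      using s by (simp add: Utilde_def is_beta_exp_def val0)
  qed
qed

text \<open>Reflection turns the lower bound after a 1 into the upper bound after a 0, so membership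
  can be proved by estimating tails after a 0 alone.\<close>

lemma Utilde_iff_flip:
  "s \<in> Utilde \<beta> \<longleftrightarrow> s \<in> binseqs \<and>
    (\<forall>k. s k = 0 \<longrightarrow> tail_val \<beta> s (Suc k) < 1) \<and>
    (\<forall>k. flip s k = 0 \<longrightarrow> tail_val \<beta> (flip s) (Suc k) < 1)"
proof (cases "s \<in> binseqs")
  case True
  have "flip s k = 0 \<longleftrightarrow> s k = 1" for k
    using binseqs_cases[OF True, of k] by (auto simp: flip_def)
  then show ?thesis
    unfolding Utilde_iff_tail_val tail_val_flip[OF \<beta>(1) True] using True
    by (simp add: diff_less_eq less_diff_eq add.commute all_conj_distrib)
qed (simp add: Utilde_def)

end

subsection \<open>The quasi-greedy expansion of one\<close>

text \<open>\<open>golden\<close> says \<open>\<beta>^2 > \<beta> + 1\<close>. Strict positivity in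
  \<open>q_pos\<close> distinguishes the quasi-greedy expansion from a finite greedy one.\<close>

locale quasi_greedy =
  fixes \<beta> :: real and \<eta> :: "nat \<Rightarrow> nat" and q :: "nat \<Rightarrow> real"
  assumes golden: "1 < \<beta> * (\<beta> - 1)" and \<beta>: "1 < \<beta>" "\<beta> < 2"
    and \<eta>: "\<eta> \<in> binseqs"
    and q: "\<And>i. q i = tail_val \<beta> \<eta> i"
    and q_0: "q 0 = 1" and q_pos: "\<And>i. 0 < q i" and q_le: "\<And>i. q i \<le> 1"
begin

lemma q_Suc: "q (Suc i) = \<beta> * q i - real (\<eta> i)"
  using tail_val_Suc[OF \<beta>(1) \<eta>] by (simp add: q)

lemma digit_one: "\<eta> i = 1 \<longleftrightarrow> 1 < \<beta> * q i"
  using q_Suc[of i] q_pos[of "Suc i"] q_le[of "Suc i"] binseqs_cases[OF \<eta>, of i] by auto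

lemma switch_iff:
  "q i \<in> {1 / \<beta> <.. 1 / (\<beta> * (\<beta> - 1))} \<longleftrightarrow> 1 < \<beta> * q i \<and> \<beta> * q i \<le> 1 / (\<beta> - 1)"
  "q i \<in> {1 / \<beta> .. 1 / (\<beta> * (\<beta> - 1))} \<longleftrightarrow> 1 \<le> \<beta> * q i \<and> \<beta> * q i \<le> 1 / (\<beta> - 1)"
proof -
  have "q i \<le> 1 / (\<beta> * (\<beta> - 1)) \<longleftrightarrow> \<beta> * q i \<le> 1 / (\<beta> - 1)"
    using \<beta> golden by (simp add: field_simps)
  then show
    "q i \<in> {1 / \<beta> <.. 1 / (\<beta> * (\<beta> - 1))} \<longleftrightarrow> 1 < \<beta> * q i \<and> \<beta> * q i \<le> 1 / (\<beta> - 1)"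
    "q i \<in> {1 / \<beta> .. 1 / (\<beta> * (\<beta> - 1))} \<longleftrightarrow> 1 \<le> \<beta> * q i \<and> \<beta> * q i \<le> 1 / (\<beta> - 1)"
    using \<beta> by (simp_all add: pos_divide_less_eq pos_divide_le_eq mult.commute)
qed

text \<open>As \<open>q 0 = 1\<close>, the orbit starts to the right of the switch region.\<close>

lemma one_above_switch: "1 / (\<beta> - 1) < \<beta>"
  using golden \<beta> by (simp add: pos_divide_less_eq)

text \<open>At the first difference from \<open>\<eta>\<close> a nonnegative excess over 1 has not
  shrunk, \<open>s\<close> reads 0, and \<open>\<beta> * q j > 1\<close>. So a tail after a 0 is
  reached again, with the excess more than multiplied by \<open>\<beta>\<close>.\<close>

lemma lexless_imp_tail_val_less_1:
  assumes s: "s \<in> binseqs" and lex: "\<And>k. s k = 0 \<Longrightarrow> lexless (\<lambda>j. s (Suc k + j)) \<eta>"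
    and "s k = 0"
  shows "tail_val \<beta> s (Suc k) < 1"
proof -
  have "tail_val \<beta> s (Suc k) - 1 < 0"
  proof (rule growth_bounded_neg[where P = "\<lambda>k. s k = 0" and B = "1 / (\<beta> - 1)"
        and f = "\<lambda>k. tail_val \<beta> s (Suc k) - 1", OF \<beta>(1)])
    show "tail_val \<beta> s (Suc k) - 1 \<le> 1 / (\<beta> - 1)" for k
      using tail_val_le[OF \<beta>(1) s, of "Suc k"] by simp
  next
    fix k
    assume "s k = 0" and nn: "0 \<le> tail_val \<beta> s (Suc k) - 1"
    from lex[OF \<open>s k = 0\<close>] obtain j where
      j: "\<forall>i<j. s (Suc k + i) = \<eta> (0 + i)" "s (Suc k + j) < \<eta> j"
      by (auto simp: lexless_def)
    have dig: "s (Suc k + j) = 0" "\<eta> j = 1"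
      using j(2) binseqs_cases[OF s, of "Suc k + j"] binseqs_cases[OF \<eta>, of j] by auto
    have "tail_val \<beta> s (Suc k + j) - q j = \<beta> ^ j * (tail_val \<beta> s (Suc k) - 1)"
      using tail_val_agree[OF \<beta>(1) s \<eta> j(1)] by (simp add: q[symmetric] q_0)
    moreover have "1 * (tail_val \<beta> s (Suc k) - 1) \<le> \<beta> ^ j * (tail_val \<beta> s (Suc k) - 1)"
      using nn \<beta> by (intro mult_right_mono one_le_power) auto
    ultimately have "tail_val \<beta> s (Suc k) - 1 + q j \<le> tail_val \<beta> s (Suc k + j)"
      by simp
    then have "\<beta> * (tail_val \<beta> s (Suc k) - 1 + q j) \<le> \<beta> * tail_val \<beta> s (Suc k + j)"
      using \<beta> by (intro mult_left_mono) auto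
    moreover have "tail_val \<beta> s (Suc (Suc k + j)) = \<beta> * tail_val \<beta> s (Suc k + j)"
      using tail_val_Suc[OF \<beta>(1) s, of "Suc k + j"] dig by simp
    moreover have "1 < \<beta> * q j"
      using dig(2) digit_one by simp
    ultimately have "\<beta> * (tail_val \<beta> s (Suc k) - 1) < tail_val \<beta> s (Suc (Suc k + j)) - 1"
      by (simp add: distrib_left)
    then show "\<exists>k'. s k' = 0 \<and> \<beta> * (tail_val \<beta> s (Suc k) - 1) < tail_val \<beta> s (Suc k') - 1"
      using dig(1) by blast
  qed fact
  then show ?thesis by simp
qed

text \<open>Reading 1 against 0 would mean \<open>q (i + j) > q j\<close>, hence
  \<open>q i > q 0 = 1\<close>. So no shift of \<open>\<eta>\<close> is lexicographically larger
  than \<open>\<eta>\<close>.\<close>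

lemma shift_le:
  assumes "\<forall>t<j. \<eta> (i + t) = \<eta> t"
  shows "\<eta> (i + j) \<le> \<eta> j"
proof (rule ccontr)
  assume "\<not> ?thesis"
  then have dig: "\<eta> (i + j) = 1" "\<eta> j \<noteq> 1"
    using binseqs_cases[OF \<eta>, of "i + j"] by auto
  have "\<beta> * q j < \<beta> * q (i + j)"
    using dig digit_one[of "i + j"] digit_one[of j] by linarith
  then have "q j < q (i + j)"
    using \<beta> by simp
  moreover have "q (i + j) - q (0 + j) = \<beta> ^ j * (q i - q 0)"
    unfolding q by (rule tail_val_agree[OF \<beta>(1) \<eta> \<eta>]) (simp add: assms)
  ultimately have "0 < \<beta> ^ j * (q i - 1)"
    using q_0 by simp
  then show False
    using q_le[of i] \<beta> by (simp add: zero_less_mult_iff)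
qed

subsection \<open>Entrance into the interior gives finitely many forbidden words\<close>

text \<open>If \<open>\<eta> i = 0\<close>, the final 1 departs upwards from \<open>\<eta>\<close>.
  At the entrance time \<open>\<eta>\<close> itself reads 1, and the word is 0 followed by a prefix
  of \<open>\<eta>\<close>.\<close>

definition forbidden :: "nat \<Rightarrow> nat list" where
  "forbidden i = 0 # map \<eta> [0..<i] @ [1]"

lemma occurs_forbidden:
  "occurs_in (forbidden i) s \<longleftrightarrow>
    (\<exists>k. s k = 0 \<and> (\<forall>t<i. s (Suc k + t) = \<eta> t) \<and> s (Suc k + i) = 1)"
proof -
  have "(\<forall>j<length (forbidden i). s (k + j) = forbidden i ! j) \<longleftrightarrow>
      s k = 0 \<and> (\<forall>t<i. s (Suc k + t) = \<eta> t) \<and> s (Suc k + i) = 1" for k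
  proof -
    have len: "length (forbidden i) = Suc (Suc i)"
      by (simp add: forbidden_def)
    have nth_0: "forbidden i ! 0 = 0"
      by (simp add: forbidden_def)
    have nth: "forbidden i ! Suc t = (if t < i then \<eta> t else 1)" if "t \<le> i" for t
      using that by (auto simp: forbidden_def nth_append)
    show ?thesis
      unfolding len by (subst All_less_Suc2) (auto simp: less_Suc_eq nth nth_0)
  qed
  then show ?thesis
    by (simp add: occurs_in_def)
qed

lemma occurs_forbidden_flip:
  assumes "s \<in> binseqs"
  shows "occurs_in (map (\<lambda>x. 1 - x) (forbidden i)) s \<longleftrightarrow> occurs_in (forbidden i) (flip s)"
proof -
  have bin: "forbidden i ! j = 0 \<or> forbidden i ! j = 1" if "j < length (forbidden i)" for j
  proof -
    have "set (forbidden i) \<subseteq> {0, 1}"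
    proof -
      have "\<eta> ` A \<subseteq> {0, 1}" for A
        using binseqs_cases[OF \<eta>] by (intro image_subsetI) simp
      then show ?thesis
        by (simp add: forbidden_def del: One_nat_def)
    qed
    then show ?thesis
      using nth_mem[OF that] by blast
  qed
  have "s n = 1 - x \<longleftrightarrow> flip s n = x" if "x = 0 \<or> x = 1" for n x
    using that binseqs_cases[OF assms, of n] by (auto simp: flip_def)
  then show ?thesis
    using bin by (auto simp: occurs_in_def)
qed

context
  fixes n :: nat
  assumes enter: "1 < \<beta> * q n" "\<beta> * q n \<le> 1 / (\<beta> - 1)"
    and before: "\<And>i. i < n \<Longrightarrow> \<beta> * q i < 1 \<or> 1 / (\<beta> - 1) < \<beta> * q i"
begin

text \<open>The final 1 forces the tail there to be at least \<open>q i\<close>: if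
  \<open>\<eta> i = 0\<close> because \<open>\<beta> * q i \<le> 1\<close>, if \<open>i = n\<close>
  because uniqueness puts the tail above the switch region. Scaled back, the tail after the initial
  0 would be at least 1.\<close>

lemma unique_avoids_forbidden:
  assumes U: "s \<in> Utilde \<beta>" and i: "i = n \<or> i < n \<and> \<eta> i = 0"
  shows "\<not> occurs_in (forbidden i) s"
proof
  assume "occurs_in (forbidden i) s"
  then obtain k where k: "s k = 0" "\<forall>t<i. s (Suc k + t) = \<eta> (0 + t)" "s (Suc k + i) = 1"
    by (auto simp: occurs_forbidden)
  from U have s: "s \<in> binseqs" and x: "tail_val \<beta> s (Suc k) < 1"
    and y: "1 / (\<beta> - 1) - 1 < tail_val \<beta> s (Suc (Suc k + i))"
    using k by (auto simp: Utilde_iff_tail_val[OF \<beta>])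
  have z: "tail_val \<beta> s (Suc (Suc k + i)) = \<beta> * tail_val \<beta> s (Suc k + i) - 1"
    using tail_val_Suc[OF \<beta>(1) s, of "Suc k + i"] k(3) by simp
  have nn: "0 \<le> tail_val \<beta> s (Suc (Suc k + i))"
    by (rule tail_val_nonneg[OF \<beta>(1) s])
  have "\<beta> * q i \<le> \<beta> * tail_val \<beta> s (Suc k + i)"
  proof (cases "i = n")
    case True
    then have "\<beta> * q i \<le> 1 / (\<beta> - 1)" using enter by simp
    then show ?thesis using y z by linarith
  next
    case False
    then have "\<beta> * q i \<le> 1"
      using i digit_one[of i] by auto
    then show ?thesis using nn z by linarith
  qed
  then have "q i \<le> tail_val \<beta> s (Suc k + i)"
    using \<beta> by simp
  moreover have "tail_val \<beta> s (Suc k + i) - q i = \<beta> ^ i * (tail_val \<beta> s (Suc k) - 1)"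
    using tail_val_agree[OF \<beta>(1) s \<eta> k(2)] by (simp add: q[symmetric] q_0)
  ultimately have "0 \<le> \<beta> ^ i * (tail_val \<beta> s (Suc k) - 1)"
    by simp
  moreover have "0 < \<beta> ^ i"
    using \<beta> by simp
  ultimately show False
    using x by (simp add: zero_le_mult_iff)
qed

text \<open>A tail of value at least 1 after a digit 0 must follow \<open>\<eta>\<close> up to the entrance time and then
  read 0, which brings it to a tail of value at least 1 after a digit 0 again, with a larger
  excess over 1. This cannot go on forever.\<close>

lemma avoids_forbidden_imp_less_1:
  assumes s: "s \<in> binseqs"
    and av: "\<And>i. i = n \<or> i < n \<and> \<eta> i = 0 \<Longrightarrow> \<not> occurs_in (forbidden i) s"
    and "s k = 0"
  shows "tail_val \<beta> s (Suc k) < 1"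
proof -
  have "tail_val \<beta> s (Suc k) - 1 < 0"
  proof (rule growth_bounded_neg[where P = "\<lambda>k. s k = 0" and B = "1 / (\<beta> - 1)"
        and f = "\<lambda>k. tail_val \<beta> s (Suc k) - 1", OF \<beta>(1)])
    show "tail_val \<beta> s (Suc k) - 1 \<le> 1 / (\<beta> - 1)" for k
      using tail_val_le[OF \<beta>(1) s, of "Suc k"] by simp
  next
    fix k
    assume k: "s k = 0" and nn: "0 \<le> tail_val \<beta> s (Suc k) - 1"
    have excess: "tail_val \<beta> s (Suc k) - 1 + q j \<le> tail_val \<beta> s (Suc k + j)"
      if "\<forall>t<j. s (Suc k + t) = \<eta> t" for j
    proof -
      have "tail_val \<beta> s (Suc k + j) - q j = \<beta> ^ j * (tail_val \<beta> s (Suc k) - 1)"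
        using tail_val_agree[OF \<beta>(1) s \<eta>, of j "Suc k" 0] that by (simp add: q[symmetric] q_0)
      moreover have "1 * (tail_val \<beta> s (Suc k) - 1) \<le> \<beta> ^ j * (tail_val \<beta> s (Suc k) - 1)"
        using nn \<beta> by (intro mult_right_mono one_le_power) auto
      ultimately show ?thesis by simp
    qed
    have agree: "j \<le> n \<Longrightarrow> \<forall>t<j. s (Suc k + t) = \<eta> t" for j
    proof (induction j)
      case (Suc j)
      then have IH: "\<forall>t<j. s (Suc k + t) = \<eta> t" and "j < n" by auto
      have "s (Suc k + j) = \<eta> j"
      proof (cases "\<eta> j = 0")
        case True
        then have "s (Suc k + j) \<noteq> 1"
          using av[of j] IH \<open>j < n\<close> k unfolding occurs_forbidden by blast
        then show ?thesis
          using True binseqs_cases[OF s, of "Suc k + j"] by auto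
      next
        case False
        then have one: "\<eta> j = 1"
          using binseqs_cases[OF \<eta>, of j] by simp
        \<comment> \<open>With \<open>q j\<close> above the switch region, reading 0 would leave
          more than the largest value of any tail.\<close>
        then have "1 / (\<beta> - 1) < \<beta> * q j"
          using before[OF \<open>j < n\<close>] digit_one[of j] by auto
        also have "\<dots> \<le> \<beta> * tail_val \<beta> s (Suc k + j)"
          using excess[OF IH] nn \<beta> by (intro mult_left_mono) auto
        finally have "s (Suc k + j) \<noteq> 0"
          using tail_val_Suc[OF \<beta>(1) s, of "Suc k + j"]
            tail_val_le[OF \<beta>(1) s, of "Suc (Suc k + j)"] by auto
        then show ?thesis
          using one binseqs_cases[OF s, of "Suc k + j"] by auto
      qed
      then show ?case
        using IH by (auto simp: less_Suc_eq)
    qed simp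
    have zero: "s (Suc k + n) = 0"
      using av[of n] agree[of n] k binseqs_cases[OF s, of "Suc k + n"]
      unfolding occurs_forbidden by blast
    have "\<beta> * (tail_val \<beta> s (Suc k) - 1 + q n) \<le> \<beta> * tail_val \<beta> s (Suc k + n)"
      using excess[OF agree[of n]] \<beta> by (intro mult_left_mono) auto
    moreover have "tail_val \<beta> s (Suc (Suc k + n)) = \<beta> * tail_val \<beta> s (Suc k + n)"
      using tail_val_Suc[OF \<beta>(1) s, of "Suc k + n"] zero by simp
    ultimately have "\<beta> * (tail_val \<beta> s (Suc k) - 1) < tail_val \<beta> s (Suc (Suc k + n)) - 1"
      using enter(1) by (simp add: distrib_left)
    then show "\<exists>k'. s k' = 0 \<and> \<beta> * (tail_val \<beta> s (Suc k) - 1) < tail_val \<beta> s (Suc k') - 1"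
      using zero by blast
  qed fact
  then show ?thesis by simp
qed

lemma is_SFT_Utilde: "is_SFT (Utilde \<beta>)"
proof -
  define I where "I = {i. i = n \<or> i < n \<and> \<eta> i = 0}"
  define F where "F = forbidden ` I \<union> (\<lambda>i. map (\<lambda>x. 1 - x) (forbidden i)) ` I"
  have "I \<subseteq> {..n}" by (auto simp: I_def)
  then have "finite F"
    by (auto simp: F_def intro: finite_subset)
  moreover have "Utilde \<beta> = {s \<in> binseqs. \<forall>w\<in>F. \<not> occurs_in w s}"
  proof (rule set_eqI)
    fix s
    show "s \<in> Utilde \<beta> \<longleftrightarrow> s \<in> {s \<in> binseqs. \<forall>w\<in>F. \<not> occurs_in w s}"
    proof (cases "s \<in> binseqs")
      case True
      have F: "(\<forall>w\<in>F. \<not> occurs_in w s) \<longleftrightarrow>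
          (\<forall>i\<in>I. \<not> occurs_in (forbidden i) s \<and> \<not> occurs_in (forbidden i) (flip s))"
        unfolding F_def ball_Un ball_simps(9) occurs_forbidden_flip[OF True] by blast
      have "s \<in> Utilde \<beta> \<Longrightarrow> flip s \<in> Utilde \<beta>"
        by (simp add: Utilde_iff_flip[OF \<beta>] flip_flip flip_binseqs)
      then have "\<forall>w\<in>F. \<not> occurs_in w s" if "s \<in> Utilde \<beta>"
        using that unique_avoids_forbidden unfolding F I_def by blast
      moreover have "s \<in> Utilde \<beta>" if "\<forall>w\<in>F. \<not> occurs_in w s"
        using that avoids_forbidden_imp_less_1[OF True]
          avoids_forbidden_imp_less_1[OF flip_binseqs[of s]] True
        unfolding F Utilde_iff_flip[OF \<beta>] I_def by blast
      ultimately show ?thesis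
        using True by blast
    qed (simp add: Utilde_def)
  qed
  ultimately show ?thesis
    unfolding is_SFT_def by blast
qed

end

subsection \<open>Otherwise the set of unique expansions is not closed\<close>

text \<open>By induction an earlier visit to the closed region is at the left endpoint. The digit
  there is 0 and the orbit restarts at 1, so the value at \<open>n\<close> already occurred at
  \<open>n - Suc k\<close>, where induction applies again.\<close>

lemma q_notin_switch:
  assumes "\<nexists>n. n \<ge> 1 \<and> 1 < \<beta> * q n \<and> \<beta> * q n \<le> 1 / (\<beta> - 1) \<and>
      (\<forall>i. 1 \<le> i \<and> i < n \<longrightarrow> \<not> (1 \<le> \<beta> * q i \<and> \<beta> * q i \<le> 1 / (\<beta> - 1)))"
  shows "\<not> (1 < \<beta> * q n \<and> \<beta> * q n \<le> 1 / (\<beta> - 1))"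
proof (induction n rule: less_induct)
  case (less n)
  show ?case
  proof
    assume n: "1 < \<beta> * q n \<and> \<beta> * q n \<le> 1 / (\<beta> - 1)"
    then have "n \<noteq> 0"
      using one_above_switch by (intro notI) (simp add: q_0)
    then obtain k where k: "1 \<le> k" "k < n" "1 \<le> \<beta> * q k" "\<beta> * q k \<le> 1 / (\<beta> - 1)"
      using assms n by (metis One_nat_def Suc_leI neq0_conv)
    then have "\<beta> * q k = 1"
      using less[of k] by auto
    then have q1: "q (Suc k) = 1"
      using q_Suc[of k] digit_one[of k] binseqs_cases[OF \<eta>, of k] by auto
    have per: "q (Suc k + j) = q j" for j
    proof (induction j)
      case (Suc j)
      have "\<eta> (Suc k + j) = \<eta> j"
        using Suc digit_one[of "Suc k + j"] digit_one[of j] binseqs_cases[OF \<eta>, of j]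
          binseqs_cases[OF \<eta>, of "Suc k + j"] by auto
      then show ?case
        using Suc q_Suc[of "Suc k + j"] q_Suc[of j] by simp
    qed (simp add: q1 q_0)
    have "q (n - Suc k) = q n"
      using per[of "n - Suc k"] k(2) by simp
    then show False
      using n less[of "n - Suc k"] k by auto
  qed
qed

context
  assumes avoid: "\<And>i. \<not> (1 < \<beta> * q i \<and> \<beta> * q i \<le> 1 / (\<beta> - 1))"
begin

text \<open>The bound is the value of \<open>flip \<eta>\<close>. A digit 1 is read only above the
  switch region, so subtracting 1 stays above the bound; a digit 0 increases the value.\<close>

lemma q_gt: "1 / (\<beta> - 1) - 1 < q i"
proof (induction i)
  case 0
  show ?case
    using one_above_switch \<beta> by (simp add: q_0)
next
  case (Suc i)
  show ?case
  proof (cases "\<eta> i = 1")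
    case True
    then show ?thesis
      using avoid[of i] digit_one[of i] q_Suc[of i] by auto
  next
    case False
    then have "q (Suc i) = \<beta> * q i"
      using q_Suc[of i] binseqs_cases[OF \<eta>, of i] by auto
    moreover have "1 * q i \<le> \<beta> * q i"
      using \<beta> q_pos[of i] by (intro mult_right_mono) auto
    ultimately show ?thesis
      using Suc by simp
  qed
qed

text \<open>If both digits were 0, \<open>q_gt\<close> scaled up would give
  \<open>q (i + j) + q j > 1 / (\<beta> - 1)\<close>. One step later the two values would sum to
  more than 2, although each is at most 1.\<close>

lemma shift_gt_flip:
  assumes "\<forall>t<j. \<eta> (i + t) = flip \<eta> t" "\<eta> (i + j) \<noteq> flip \<eta> j"
  shows "\<eta> (i + j) = 1" "\<eta> j = 1"
proof -
  have "\<not> (\<eta> (i + j) = 0 \<and> \<eta> j = 0)"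
  proof
    assume z: "\<eta> (i + j) = 0 \<and> \<eta> j = 0"
    have "q (i + j) - tail_val \<beta> (flip \<eta>) (0 + j) = \<beta> ^ j * (q i - tail_val \<beta> (flip \<eta>) 0)"
      unfolding q by (rule tail_val_agree[OF \<beta>(1) \<eta> flip_binseqs]) (simp add: assms)
    then have eq: "q (i + j) - (1 / (\<beta> - 1) - q j) = \<beta> ^ j * (q i - (1 / (\<beta> - 1) - 1))"
      by (simp add: tail_val_flip[OF \<beta>(1) \<eta>] q[symmetric] q_0)
    have "0 < \<beta> ^ j * (q i - (1 / (\<beta> - 1) - 1))"
      using q_gt[of i] \<beta> by (intro mult_pos_pos) auto
    then have "1 / (\<beta> - 1) < q (i + j) + q j"
      using eq by linarith
    then have "\<beta> * (1 / (\<beta> - 1)) < \<beta> * (q (i + j) + q j)"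
      using \<beta> by (intro mult_strict_left_mono) auto
    then have "1 / (\<beta> - 1) + 1 < q (Suc (i + j)) + q (Suc j)"
      using z q_Suc[of "i + j"] q_Suc[of j] \<beta> by (simp add: field_simps)
    moreover have "1 \<le> 1 / (\<beta> - 1)"
      using \<beta> by simp
    ultimately show False
      using q_le[of "Suc (i + j)"] q_le[of "Suc j"] by linarith
  qed
  then show "\<eta> (i + j) = 1" "\<eta> j = 1"
    using assms(2) binseqs_cases[OF \<eta>, of "i + j"] binseqs_cases[OF \<eta>, of j]
    by (auto simp: flip_def)
qed

lemma shift_neq_flip: "\<exists>j. \<eta> (i + j) \<noteq> flip \<eta> j"
proof (rule ccontr)
  assume "\<not> ?thesis"
  then have "q i = tail_val \<beta> (flip \<eta>) 0"
    by (simp add: q tail_val_def)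
  then show False
    using q_gt[of i] by (simp add: tail_val_flip[OF \<beta>(1) \<eta>] q[symmetric] q_0)
qed

definition mismatch :: "nat \<Rightarrow> nat" where
  "mismatch i = (LEAST j. \<eta> (i + j) \<noteq> flip \<eta> j)"

lemma before_mismatch: "t < mismatch i \<Longrightarrow> \<eta> (i + t) = 1 - \<eta> t"
  using not_less_Least[of t "\<lambda>j. \<eta> (i + j) \<noteq> flip \<eta> j"] by (simp add: mismatch_def flip_def)

lemma at_mismatch: "\<eta> (i + mismatch i) = 1" "\<eta> (mismatch i) = 1"
proof -
  have "\<eta> (i + mismatch i) \<noteq> flip \<eta> (mismatch i)"
    unfolding mismatch_def by (rule LeastI_ex[OF shift_neq_flip])
  moreover have "\<forall>t<mismatch i. \<eta> (i + t) = flip \<eta> t"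
    using before_mismatch by (simp add: flip_def)
  ultimately show "\<eta> (i + mismatch i) = 1" "\<eta> (mismatch i) = 1"
    using shift_gt_flip by blast+
qed

text \<open>Two stretches along which \<open>\<eta>\<close> copies a prefix of its own reflection are nested or disjoint,
  for otherwise some shift of \<open>\<eta>\<close> would exceed \<open>\<eta>\<close>. So the end of the leftmost stretch reaching
  beyond \<open>N\<close> is not covered by any other one.\<close>

lemma good_length:
  obtains m where "N < m" "\<And>i. i < m \<Longrightarrow> i + mismatch i < m"
proof -
  define i where "i = (LEAST i. N \<le> i + mismatch i)"
  have i: "N \<le> i + mismatch i"
    unfolding i_def by (rule LeastI[of _ N]) simp
  have less: "a + mismatch a < N" if "a < i" for a
    using not_less_Least[of a] that unfolding i_def by (meson not_le)
  have good: "a + mismatch a \<le> i + mismatch i" if "a \<le> i + mismatch i" for a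
  proof (cases "a \<le> i")
    case True
    then show ?thesis
      using less[of a] i by (cases "a = i") auto
  next
    case False
    show ?thesis
    proof (rule ccontr)
      assume nle: "\<not> ?thesis"
      \<comment> \<open>Counted from \<open>a\<close>, this is where the stretch from
        \<open>i\<close> ends. Before it \<open>\<eta>\<close> is reflected twice, so its shift by
        \<open>a - i\<close> agrees with \<open>\<eta>\<close>; at \<open>t\<close> that shift reads
        1 against 0.\<close>
      define t where "t = i + mismatch i - a"
      have t: "t < mismatch a" "a + t = i + mismatch i" "(a - i) + t = mismatch i"
        using nle that False by (auto simp: t_def)
      have "\<eta> (a - i + b) = \<eta> b" if "b < t" for b
      proof -
        have "\<eta> (a + b) = 1 - \<eta> b"
          using that t(1) by (intro before_mismatch) simp
        moreover have "\<eta> (i + (a - i + b)) = 1 - \<eta> (a - i + b)"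
          using that t(3) by (intro before_mismatch) simp
        ultimately show ?thesis
          using False binseqs_cases[OF \<eta>, of b] binseqs_cases[OF \<eta>, of "a - i + b"] by auto
      qed
      then have "\<eta> (a - i + t) \<le> \<eta> t"
        by (intro shift_le) simp
      moreover have "\<eta> t = 0"
        using before_mismatch[OF t(1)] t(2) at_mismatch(1)[of i] binseqs_cases[OF \<eta>, of t] by auto
      ultimately show False
        using t(3) at_mismatch(2)[of i] by simp
    qed
  qed
  \<comment> \<open>The successor keeps the mismatching positions themselves below
    \<open>m\<close>.\<close>
  show thesis
    by (rule that[of "Suc (i + mismatch i)"]) (use i good in \<open>auto simp: less_Suc_eq_le\<close>)
qed

section \<open>Periodic approximations of \<open>\<eta>\<close>\<close>

context
  fixes m :: nat
  assumes m_pos: "0 < m" and good: "\<And>i. i < m \<Longrightarrow> i + mismatch i < m"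
begin

text \<open>With \<open>w\<close> the first \<open>m\<close> digits of \<open>\<eta>\<close> and
  \<open>w'\<close> its reflection, this is \<open>w w' w w' ...\<close>; shifting it by
  \<open>m\<close> reflects it.\<close>

definition approx :: "nat \<Rightarrow> nat" where
  "approx k = (if even (k div m) then \<eta> (k mod m) else 1 - \<eta> (k mod m))"

lemma approx_prefix: "k < m \<Longrightarrow> approx k = \<eta> k"
  by (simp add: approx_def)

lemma approx_binseqs: "approx \<in> binseqs"
  using \<eta> by (auto simp: binseqs_def approx_def)

lemma approx_add_m: "approx (m + k) = 1 - approx k"
  using m_pos binseqs_cases[OF \<eta>, of "k mod m"] by (auto simp: approx_def)

text \<open>Between \<open>m\<close> and the first difference \<open>d\<close>,
  \<open>\<eta>\<close> copies \<open>flip \<eta>\<close>. By \<open>shift_gt_flip\<close> it leaves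
  that copy upwards at \<open>d\<close>, where \<open>approx\<close> still has the reflected
  digit.\<close>

lemma approx_lexless: "lexless approx \<eta>"
proof -
  have "\<exists>d. approx d \<noteq> \<eta> d"
  proof (rule ccontr)
    assume "\<not> ?thesis"
    then have "\<eta> (m + j) = flip \<eta> j" for j
      using approx_add_m[of j] by (simp add: flip_def)
    then show False
      using shift_neq_flip[of m] by simp
  qed
  define d where "d = (LEAST d. approx d \<noteq> \<eta> d)"
  have d: "approx d \<noteq> \<eta> d"
    unfolding d_def by (rule LeastI_ex) fact
  have less: "approx t = \<eta> t" if "t < d" for t
    using not_less_Least[of t] that unfolding d_def by blast
  have "m \<le> d"
    using d approx_prefix by (meson not_le)
  have ap: "approx d = flip \<eta> (d - m)"
    using approx_add_m[of "d - m"] less[of "d - m"] \<open>m \<le> d\<close> m_pos by (simp add: flip_def)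
  have "\<forall>t<d - m. \<eta> (m + t) = flip \<eta> t"
  proof (intro allI impI)
    show "\<eta> (m + t) = flip \<eta> t" if "t < d - m" for t
      using less[of t] less[of "m + t"] approx_add_m[of t] that by (simp add: flip_def)
  qed
  moreover have "\<eta> (m + (d - m)) \<noteq> flip \<eta> (d - m)"
    using d ap \<open>m \<le> d\<close> by simp
  ultimately have "\<eta> (m + (d - m)) = 1"
    by (rule shift_gt_flip)
  then have "approx d < \<eta> d"
    using d \<open>m \<le> d\<close> binseqs_cases[OF approx_binseqs, of d] by auto
  then show ?thesis
    using less by (auto simp: lexless_def)
qed

text \<open>Let \<open>0 < i\<close>. If the rest of the block is not a prefix of
  \<open>\<eta>\<close>, \<open>shift_le\<close> decides inside the block. If it is, of length
  \<open>p\<close>, then \<open>approx\<close> goes on with \<open>flip \<eta>\<close> while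
  \<open>\<eta>\<close> goes on from \<open>p\<close>, and \<open>good\<close> puts their mismatch,
  with \<open>\<eta>\<close> the larger, before \<open>m\<close>.\<close>

lemma approx_shift_lexless_prefix:
  assumes "i < m"
  shows "lexless (\<lambda>j. approx (i + j)) \<eta>"
proof (cases "i = 0")
  case True
  then show ?thesis using approx_lexless by simp
next
  case False
  show ?thesis
  proof (cases "\<forall>t<m - i. \<eta> (i + t) = \<eta> t")
    case True
    define p where "p = m - i"
    have p: "p < m" "i + p = m"
      using assms False by (auto simp: p_def)
    define e where "e = mismatch p"
    have e: "p + e < m"
      using good[OF p(1)] by (simp add: e_def)
    have shifted: "approx (i + (p + t)) = 1 - \<eta> t" if "t \<le> e" for t
    proof -
      have "approx (i + (p + t)) = approx (m + t)"
        using p(2) by (simp add: add.assoc[symmetric])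
      then show ?thesis
        using that e by (simp add: approx_add_m approx_prefix)
    qed
    have "approx (i + j) = \<eta> j" if "j < p + e" for j
    proof (cases "j < p")
      case True
      then show ?thesis
        using \<open>\<forall>t<m - i. \<eta> (i + t) = \<eta> t\<close> p by (simp add: approx_prefix p_def)
    next
      case False
      then have "j - p < e" "p + (j - p) = j" using that by auto
      then show ?thesis
        using shifted[of "j - p"] before_mismatch[of "j - p" p] by (simp add: e_def)
    qed
    moreover have "approx (i + (p + e)) < \<eta> (p + e)"
      using shifted[of e] at_mismatch[of p] by (simp add: e_def)
    ultimately show ?thesis
      unfolding lexless_def by blast
  next
    case False
    then have ex: "\<exists>t. \<eta> (i + t) \<noteq> \<eta> t" by blast
    define t where "t = (LEAST t. \<eta> (i + t) \<noteq> \<eta> t)"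
    have less: "\<eta> (i + a) = \<eta> a" if "a < t" for a
      using not_less_Least[of a] that unfolding t_def by blast
    have t: "\<eta> (i + t) \<noteq> \<eta> t"
      unfolding t_def by (rule LeastI_ex[OF ex])
    have "t < m - i"
      using False less by (metis linorder_neqE_nat order_less_trans t)
    moreover have "\<eta> (i + t) < \<eta> t"
      using shift_le[of t i] less t by (simp add: order_less_le)
    ultimately show ?thesis
      unfolding lexless_def using less by (intro exI[of _ t]) (auto simp: approx_prefix)
  qed
qed

text \<open>By \<open>good\<close>, the place where \<open>\<eta>\<close> shifted by
  \<open>i\<close> leaves \<open>flip \<eta>\<close> is inside the block; there the reflected digit
  is 0 and \<open>\<eta>\<close> has 1.\<close>

lemma flip_approx_shift_lexless_prefix:
  assumes "i < m"
  shows "lexless (\<lambda>j. flip approx (i + j)) \<eta>"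
  unfolding lexless_def
proof (intro exI[of _ "mismatch i"] conjI allI impI)
  note e = good[OF assms]
  show "flip approx (i + t) = \<eta> t" if "t < mismatch i" for t
    using before_mismatch[OF that] that e binseqs_cases[OF \<eta>, of t]
    by (auto simp: flip_def approx_prefix)
  show "flip approx (i + mismatch i) < \<eta> (mismatch i)"
    using e at_mismatch[of i] by (simp add: flip_def approx_prefix)
qed

text \<open>Shifting by \<open>m\<close> exchanges \<open>approx\<close> and its reflection, which
  reduces everything to \<open>k < m\<close>.\<close>

lemma approx_shift_lexless:
  "lexless (\<lambda>j. approx (k + j)) \<eta> \<and> lexless (\<lambda>j. flip approx (k + j)) \<eta>"
proof (induction k rule: less_induct)
  case (less k)
  show ?case
  proof (cases "k < m")
    case True
    then show ?thesis
      using approx_shift_lexless_prefix flip_approx_shift_lexless_prefix by blast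
  next
    case False
    have a: "approx (k + j) = flip approx (k - m + j)" for j
      using approx_add_m[of "k - m + j"] False by (simp add: flip_def)
    then have "flip approx (k + j) = approx (k - m + j)" for j
      using binseqs_cases[OF approx_binseqs, of "k - m + j"] by (auto simp: flip_def)
    then show ?thesis
      using less[of "k - m"] a False m_pos by simp
  qed
qed

text \<open>Every tail after a digit of this sequence or its reflection is a shift of
  \<open>approx\<close> or \<open>flip approx\<close>.\<close>

lemma zero_approx_Utilde: "case_nat 0 approx \<in> Utilde \<beta>"
proof -
  let ?s = "case_nat 0 approx"
  have s: "?s \<in> binseqs"
    using approx_binseqs by (auto simp: binseqs_def split: nat.split)
  moreover have "tail_val \<beta> ?s (Suc k) < 1" if "?s k = 0" for k
    using s _ that by (rule lexless_imp_tail_val_less_1) (simp add: approx_shift_lexless)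
  moreover have "tail_val \<beta> (flip ?s) (Suc k) < 1" if "flip ?s k = 0" for k
    using flip_binseqs _ that
  proof (rule lexless_imp_tail_val_less_1)
    show "lexless (\<lambda>j. flip ?s (Suc l + j)) \<eta>" for l
      using approx_shift_lexless[of l] by (simp add: flip_def)
  qed
  ultimately show ?thesis
    by (simp add: Utilde_iff_flip[OF \<beta>])
qed

end

lemma not_is_SFT_Utilde: "\<not> is_SFT (Utilde \<beta>)"
proof
  assume "is_SFT (Utilde \<beta>)"
  then obtain F where F: "Utilde \<beta> = {s \<in> binseqs. \<forall>w\<in>F. \<not> occurs_in w s}"
    by (auto simp: is_SFT_def)
  let ?s = "case_nat 0 \<eta>"
  have s: "?s \<in> binseqs"
    using \<eta> by (auto simp: binseqs_def split: nat.split)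
  have "tail_val \<beta> ?s (Suc 0) = 1"
    using q_0 by (simp add: q tail_val_def)
  then have "?s \<notin> Utilde \<beta>"
    by (auto simp: Utilde_iff_tail_val[OF \<beta>] intro!: exI[of _ 0])
  then obtain w k where w: "w \<in> F" "\<forall>i<length w. ?s (k + i) = w ! i"
    using s by (auto simp: F occurs_in_def)
  \<comment> \<open>With \<open>m\<close> beyond the window in which \<open>w\<close> occurs,
    replacing \<open>\<eta>\<close> by \<open>approx m\<close> leaves that window unchanged.\<close>
  obtain m where m: "k + length w < m" "\<And>i. i < m \<Longrightarrow> i + mismatch i < m"
    using good_length[of "k + length w"] by blast
  then have "0 < m" by simp
  have "case_nat 0 (approx m) (k + i) = ?s (k + i)" if "i < length w" for i
    using m(1) that by (auto simp: approx_prefix[OF \<open>0 < m\<close> m(2)] split: nat.split)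
  then have "occurs_in w (case_nat 0 (approx m))"
    using w(2) by (auto simp: occurs_in_def)
  then show False
    using zero_approx_Utilde[OF \<open>0 < m\<close> m(2)] w(1) by (auto simp: F)
qed

end

end

subsection \<open>The greedy algorithm\<close>

context
  fixes \<beta> :: real
  assumes \<beta>: "1 < \<beta>" "\<beta> < 2"
begin

lemma greedy_orbit_range:
  "0 \<le> (greedy_map \<beta> ^^ n) 1 \<and> (greedy_map \<beta> ^^ n) 1 \<le> 1 \<and> (n \<noteq> 0 \<longrightarrow> (greedy_map \<beta> ^^ n) 1 < 1)"
proof (induction n)
  case (Suc n)
  let ?r = "(greedy_map \<beta> ^^ n) 1"
  have "0 \<le> greedy_map \<beta> ?r \<and> greedy_map \<beta> ?r < 1"
  proof (cases "?r < 1")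
    case True
    then show ?thesis
      using frac_ge_0[of "\<beta> * ?r"] frac_lt_1[of "\<beta> * ?r"] by (simp add: greedy_map_def frac_def)
  next
    case False
    then have "?r = 1" using Suc by auto
    then show ?thesis
      using \<beta> by (simp add: greedy_map_def)
  qed
  then show ?case by simp
qed simp

lemma greedy_digits: "greedy_exp \<beta> 1 \<in> binseqs"
proof -
  have "greedy_exp \<beta> 1 n \<in> {0, 1}" for n
  proof -
    let ?r = "(greedy_map \<beta> ^^ n) 1"
    have "0 \<le> \<beta> * ?r"
      using greedy_orbit_range[of n] \<beta> by simp
    moreover have "\<beta> * ?r \<le> \<beta> * 1"
      using greedy_orbit_range[of n] \<beta> by (intro mult_left_mono) auto
    ultimately have "0 \<le> \<lfloor>\<beta> * ?r\<rfloor>" "\<lfloor>\<beta> * ?r\<rfloor> < 2"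
      using \<beta>(2) unfolding floor_less_iff zero_le_floor of_int_numeral by linarith+
    then have "\<lfloor>\<beta> * ?r\<rfloor> = 0 \<or> \<lfloor>\<beta> * ?r\<rfloor> = 1"
      by linarith
    then show ?thesis
      by (metis greedy_exp_def insertCI nat_0 nat_one_as_int of_nat_1)
  qed
  then show ?thesis by (simp add: binseqs_def)
qed

lemma greedy_orbit_Suc:
  "(greedy_map \<beta> ^^ Suc n) 1 = \<beta> * (greedy_map \<beta> ^^ n) 1 - real (greedy_exp \<beta> 1 n)"
proof (cases "(greedy_map \<beta> ^^ n) 1 < 1")
  case True
  then show ?thesis
    using greedy_orbit_range[of n] \<beta> by (simp add: greedy_map_def greedy_exp_def)
next
  case False
  then have "(greedy_map \<beta> ^^ n) 1 = 1"
    using greedy_orbit_range[of n] by auto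
  moreover have "\<lfloor>\<beta>\<rfloor> = 1"
    using \<beta> by (simp add: floor_eq_iff)
  ultimately show ?thesis
    by (simp add: greedy_map_def greedy_exp_def)
qed

lemma greedy_exp_0: "greedy_exp \<beta> 1 0 = 1"
proof -
  have "\<lfloor>\<beta>\<rfloor> = 1"
    using \<beta> by (simp add: floor_eq_iff)
  then show ?thesis by (simp add: greedy_exp_def)
qed

text \<open>An infinite greedy expansion keeps its orbit, since a value 0 would make all later
  digits 0. For a finite one the orbit is repeated with period \<open>Suc m\<close>: lowering the
  last digit 1 replaces the final value 0 by 1.\<close>

lemma quasi_greedy_orbit:
  obtains r where "quasi_greedy_one \<beta> \<in> binseqs" "r 0 = 1" "\<And>i. 0 < r i" "\<And>i. r i \<le> 1"
    "\<And>i. r (Suc i) = \<beta> * r i - real (quasi_greedy_one \<beta> i)"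
proof (cases "infinite {n. greedy_exp \<beta> 1 n \<noteq> 0}")
  case True
  define r where "r i = (greedy_map \<beta> ^^ i) 1" for i
  have eq: "quasi_greedy_one \<beta> = greedy_exp \<beta> 1"
    using True by (simp add: quasi_greedy_one_def)
  have rng: "0 \<le> r i" "r i \<le> 1" for i
    using greedy_orbit_range[of i] by (auto simp: r_def)
  have step: "r (Suc i) = \<beta> * r i - real (greedy_exp \<beta> 1 i)" for i
    unfolding r_def by (rule greedy_orbit_Suc)
  have "r i \<noteq> 0" for i
  proof
    assume "r i = 0"
    then have zero: "r (i + j) = 0" for j
    proof (induction j)
      case (Suc j)
      then show ?case using step[of "i + j"] rng(1)[of "Suc (i + j)"] by simp
    qed simp
    have "greedy_exp \<beta> 1 n = 0" if "i \<le> n" for n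
      using zero[of "n - i"] zero[of "Suc n - i"] that step[of n] by (simp add: Suc_diff_le)
    then have "{n. greedy_exp \<beta> 1 n \<noteq> 0} \<subseteq> {..<i}"
      by (auto intro: ccontr)
    then show False
      using True finite_subset by blast
  qed
  then have "0 < r i" for i
    using rng(1)[of i] by (simp add: order_less_le)
  then show thesis
    using that[of r] rng(2) step greedy_digits by (simp add: eq r_def)
next
  case False
  define g where "g = greedy_exp \<beta> 1"
  define m where "m = Max {n. g n \<noteq> 0}"
  define \<rho> where "\<rho> i = (greedy_map \<beta> ^^ i) 1" for i
  define r where "r i = \<rho> (i mod Suc m)" for i
  have fin: "finite {n. g n \<noteq> 0}"
    using False by (simp add: g_def)
  have ne: "{n. g n \<noteq> 0} \<noteq> {}"
  proof -
    have "g 0 \<noteq> 0"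
      using greedy_exp_0 by (simp add: g_def)
    then show ?thesis by blast
  qed
  have g: "g \<in> binseqs"
    using greedy_digits by (simp add: g_def)
  have gm: "g m = 1"
    using Max_in[OF fin ne] binseqs_cases[OF g, of m] by (simp add: m_def)
  have g_zero: "g n = 0" if "m < n" for n
    using Max_ge[OF fin, of n] that by (auto simp: m_def)
  have eq: "quasi_greedy_one \<beta> = (\<lambda>k. if k mod Suc m = m then 0 else g (k mod Suc m))"
  proof -
    have "quasi_greedy_one \<beta> = (\<lambda>k. if k mod Suc m = m then g m - 1 else g (k mod Suc m))"
      using fin unfolding quasi_greedy_one_def Let_def g_def m_def by (intro if_not_P) blast
    then show ?thesis
      by (simp add: gm cong: if_cong)
  qed
  have rng: "0 \<le> \<rho> i" "\<rho> i \<le> 1" for i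
    using greedy_orbit_range[of i] by (auto simp: \<rho>_def)
  have step: "\<rho> (Suc i) = \<beta> * \<rho> i - real (g i)" for i
    unfolding \<rho>_def g_def by (rule greedy_orbit_Suc)
  have "\<rho> (Suc m) = tail_val \<beta> g (Suc m)"
    by (rule tail_val_unique[OF \<beta>(1) g step, of 1, symmetric]) (use rng in auto)
  also have "\<dots> = 0"
    by (simp add: tail_val_def beta_val_def g_zero)
  finally have last: "\<beta> * \<rho> m = 1"
    using step[of m] gm by simp
  have bin: "quasi_greedy_one \<beta> \<in> binseqs"
    using g by (auto simp: eq binseqs_def)
  have r_step: "r (Suc i) = \<beta> * r i - real (quasi_greedy_one \<beta> i)" for i
    using last step[of "i mod Suc m"] by (auto simp: r_def eq mod_Suc \<rho>_def)
  have "r i \<noteq> 0" for i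
  proof
    assume "r i = 0"
    then have zero: "r (i + j) = 0" for j
    proof (induction j)
      case (Suc j)
      then show ?case using r_step[of "i + j"] rng(1)[of "Suc (i + j) mod Suc m"] by (simp add: r_def)
    qed simp
    \<comment> \<open>A multiple of the period that is not before \<open>i\<close>.\<close>
    have "r (i * Suc m) = 1"
      by (simp add: r_def \<rho>_def del: mult_Suc_right)
    then show False
      using zero[of "i * m"] by simp
  qed
  then have "0 < r i" for i
    using rng(1) by (simp add: r_def order_less_le)
  then show thesis
    using that[of r] rng(2) r_step bin by (simp add: r_def \<rho>_def)
qed

end

theorem theorem3p7:
  fixes \<beta> :: real
  assumes "(1 + sqrt 5) / 2 < \<beta>" and "\<beta> < 2"
  shows "is_SFT (Utilde \<beta>) \<longleftrightarrow>
    (\<exists>n\<ge>1. Q_orbit \<beta> n \<in> {1/\<beta> <.. 1/(\<beta> * (\<beta> - 1))} \<and>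
       (\<forall>i. 1 \<le> i \<and> i < n \<longrightarrow> Q_orbit \<beta> i \<notin> {1/\<beta> .. 1/(\<beta> * (\<beta> - 1))}))"
proof -
  have "2 < sqrt 5"
    by (rule real_less_rsqrt) simp
  then have "1 < \<beta>"
    using assms(1) by simp
  have golden: "1 < \<beta> * (\<beta> - 1)"
  proof -
    have "sqrt 5 < 2 * \<beta> - 1"
      using assms(1) by simp
    then have "(sqrt 5)\<^sup>2 < (2 * \<beta> - 1)\<^sup>2"
      by (intro power_strict_mono) auto
    then show ?thesis
      by (simp add: power2_eq_square algebra_simps)
  qed
  obtain r where r: "quasi_greedy_one \<beta> \<in> binseqs" "r 0 = 1" "\<And>i. 0 < r i" "\<And>i. r i \<le> 1"
    "\<And>i. r (Suc i) = \<beta> * r i - real (quasi_greedy_one \<beta> i)"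
    by (rule quasi_greedy_orbit[OF \<open>1 < \<beta>\<close> \<open>\<beta> < 2\<close>]) blast
  have rQ: "r i = Q_orbit \<beta> i" for i
    unfolding Q_orbit_eq_tail_val
    by (rule tail_val_unique[OF \<open>1 < \<beta>\<close> r(1,5), of 1, symmetric])
      (use r(3,4) in \<open>simp add: abs_of_pos\<close>)
  interpret quasi_greedy \<beta> "quasi_greedy_one \<beta>" "Q_orbit \<beta>"
    using golden \<open>1 < \<beta>\<close> \<open>\<beta> < 2\<close> r(1-4) by unfold_locales (auto simp: rQ Q_orbit_eq_tail_val)
  show ?thesis
    unfolding switch_iff
  proof
    assume "is_SFT (Utilde \<beta>)"
    then show "\<exists>n\<ge>1. (1 < \<beta> * Q_orbit \<beta> n \<and> \<beta> * Q_orbit \<beta> n \<le> 1 / (\<beta> - 1)) \<and>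
        (\<forall>i. 1 \<le> i \<and> i < n \<longrightarrow> \<not> (1 \<le> \<beta> * Q_orbit \<beta> i \<and> \<beta> * Q_orbit \<beta> i \<le> 1 / (\<beta> - 1)))"
      using not_is_SFT_Utilde q_notin_switch by blast
  next
    assume "\<exists>n\<ge>1. (1 < \<beta> * Q_orbit \<beta> n \<and> \<beta> * Q_orbit \<beta> n \<le> 1 / (\<beta> - 1)) \<and>
        (\<forall>i. 1 \<le> i \<and> i < n \<longrightarrow> \<not> (1 \<le> \<beta> * Q_orbit \<beta> i \<and> \<beta> * Q_orbit \<beta> i \<le> 1 / (\<beta> - 1)))"
    then obtain n where n: "1 < \<beta> * Q_orbit \<beta> n" "\<beta> * Q_orbit \<beta> n \<le> 1 / (\<beta> - 1)"
      and before: "\<And>i. 1 \<le> i \<Longrightarrow> i < n \<Longrightarrow>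
        \<not> (1 \<le> \<beta> * Q_orbit \<beta> i \<and> \<beta> * Q_orbit \<beta> i \<le> 1 / (\<beta> - 1))"
      by blast
    show "is_SFT (Utilde \<beta>)"
    proof (rule is_SFT_Utilde[OF n])
      \<comment> \<open>Time 0 is not among the times covered by \<open>before\<close>; there the
        value 1 is to the right of the switch region.\<close>
      show "\<beta> * Q_orbit \<beta> i < 1 \<or> 1 / (\<beta> - 1) < \<beta> * Q_orbit \<beta> i" if "i < n" for i
        using before[of i] that one_above_switch q_0 by (cases "i = 0") (auto simp: not_le)
    qed
  qed
qed

end
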